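(* Let $H(z)\in\mathbb{C}[[z]]^{\times n}$ with $o(H(z))\ge 2$, and let $N_t(z)\in\mathbb{C}[t][[z]]^{\times n}$ with $o(N_t(z))\ge 2$. Then $G_t(z)=z+tN_t(z)$ is the formal inverse of $F_t(z)=z-tH(z)$ if and only if $N_t(z)$ is the unique solution of the Cauchy problem $$\frac{\partial N_t}{\partial t}=JN_t\cdot N_t,\qquad N_{t=0}(z)=H(z),$$ where $JN_t$ is the Jacobian matrix of $N_t(z)$ with respect to $z$.
   Context: $z=(z_1,\dots,z_n)$; $t$ is a formal parameter; $\mathbb{C}[t][[z]]$ is the ring of formal power series in $z$ with coefficients in $\mathbb{C}[t]$. Elements of $\mathbb{C}[[z]]^{\times n}$ and $\mathbb{C}[t][[z]]^{\times n}$ are column vectors of $n$ series. For such a vector $U$, $o(U(z))\ge k$ means that every monomial in $z$ occurring in any component of $U$ has total degree (in $z$) at least $k$. $JU=(\partial U_i/\partial z_j)_{i,j}$ is the Jacobian matrix with respect to $z$ only, and $JN_t\cdot N_t$ is the matrix-vector product. $G_t$ is the formal inverse of $F_t$ if $F_t(G_t(z))=G_t(F_t(z))=z$ (composition in $z$, with $t$ a parameter). Solutions of the Cauchy problem are understood as formal power series in both $t$ and $z$. *)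

theory Defs
  imports "HOL-Analysis.Finite_Cartesian_Product" "HOL-Computational_Algebra.Polynomial_FPS"
begin

text \<open>
  Formal power series over a commutative ring in the \<open>CARD('n)\<close> variables \<open>z\<^sub>i\<close>, \<open>i :: 'n\<close>:
  a series is the family of its coefficients, indexed by the exponent vectors \<open>m :: nat ^ 'n\<close>
  of the monomials \<open>z\<^sup>m\<close>.
\<close>

typedef ('a, 'n::finite) mfps = "UNIV :: (nat ^ 'n \<Rightarrow> 'a) set"
  morphisms mfps_nth Abs_mfps by simp

lemma mfps_nth_Abs [simp]: "mfps_nth (Abs_mfps f) = f"
  by (simp add: Abs_mfps_inverse)

lemma mfps_eq_iff: "f = g \<longleftrightarrow> (\<forall>m. mfps_nth f m = mfps_nth g m)"
  by (auto simp flip: mfps_nth_inject)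

lemma finite_vec_le: "finite {a :: nat ^ 'n::finite. \<forall>i. a $ i \<le> m $ i}"
proof (rule finite_subset)
  show "{a :: nat ^ 'n. \<forall>i. a $ i \<le> m $ i}
          \<subseteq> vec_lambda ` (\<Pi>\<^sub>E i\<in>UNIV. {..m $ i})"
    by (auto simp: image_iff intro!: bexI[of _ "vec_nth _"])
qed (auto intro!: finite_imageI finite_PiE)

lemma finite_vec_sum_eq: "finite {(a, b). a + b = (m :: nat ^ 'n::finite)}"
  by (rule finite_subset[OF _ finite_cartesian_product[OF finite_vec_le[of m] finite_vec_le[of m]]])
     (auto simp: vec_eq_iff, (metis le_add1 le_add2)+)

instantiation mfps :: (comm_ring_1, finite) comm_ring_1
begin

definition "0 = Abs_mfps (\<lambda>_. 0)"
definition "1 = Abs_mfps (\<lambda>m. if m = 0 then 1 else 0)"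
definition "f + g = Abs_mfps (\<lambda>m. mfps_nth f m + mfps_nth g m)"
definition "- f = Abs_mfps (\<lambda>m. - mfps_nth f m)"
definition "f - g = Abs_mfps (\<lambda>m. mfps_nth f m - mfps_nth g m)"
definition "f * g = Abs_mfps (\<lambda>m. \<Sum>(a, b) | a + b = m. mfps_nth f a * mfps_nth g b)"

instance
proof
  fix f g h :: "('a, 'b) mfps"
  show "f * g * h = f * (g * h)"
  proof (unfold mfps_eq_iff, intro allI)
    fix m
    have "mfps_nth (f * g * h) m =
      (\<Sum>((d, c), (a, b)) \<in> Sigma {(d, c). d + c = m} (\<lambda>(d, c). {(a, b). a + b = d}).
         mfps_nth f a * mfps_nth g b * mfps_nth h c)"
      by (subst sum.Sigma[symmetric])
         (auto simp: times_mfps_def sum_distrib_right finite_vec_sum_eq intro!: sum.cong)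
    also have "\<dots> =
      (\<Sum>((a, e), (b, c)) \<in> Sigma {(a, e). a + e = m} (\<lambda>(a, e). {(b, c). b + c = e}).
         mfps_nth f a * mfps_nth g b * mfps_nth h c)"
      by (rule sum.reindex_bij_witness
            [where i = "\<lambda>((a, e), (b, c)). ((a + b, c), (a, b))"
               and j = "\<lambda>((d, c), (a, b)). ((a, b + c), (b, c))"])
         (auto simp: add.assoc)
    also have "\<dots> = mfps_nth (f * (g * h)) m"
      by (subst sum.Sigma[symmetric])
         (auto simp: times_mfps_def sum_distrib_left finite_vec_sum_eq mult.assoc intro!: sum.cong)
    finally show "mfps_nth (f * g * h) m = mfps_nth (f * (g * h)) m" .
  qed
  show "f * g = g * f"
    unfolding mfps_eq_iff times_mfps_def
    by (auto intro!: sum.reindex_bij_witness[where i = prod.swap and j = prod.swap]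
             simp: add.commute mult.commute)
  show "1 * f = f"
  proof (unfold mfps_eq_iff, intro allI)
    fix m
    have "mfps_nth (1 * f) m = (\<Sum>(a, b) \<in> {(0, m)}. mfps_nth 1 a * mfps_nth f b)"
      unfolding times_mfps_def mfps_nth_Abs
      by (rule sum.mono_neutral_right) (auto simp: finite_vec_sum_eq one_mfps_def split: if_splits)
    then show "mfps_nth (1 * f) m = mfps_nth f m"
      by (simp add: one_mfps_def)
  qed
  show "(f + g) * h = f * h + g * h"
    unfolding mfps_eq_iff
    by (auto simp: times_mfps_def plus_mfps_def algebra_simps sum.distrib case_prod_unfold)
  show "(0 :: ('a, 'b) mfps) \<noteq> 1"
    unfolding mfps_eq_iff by (auto simp: zero_mfps_def one_mfps_def)
qed (auto simp: mfps_eq_iff plus_mfps_def zero_mfps_def uminus_mfps_def minus_mfps_def)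

end

definition mfps_const :: "'a::comm_ring_1 \<Rightarrow> ('a, 'n::finite) mfps" where
  "mfps_const c = Abs_mfps (\<lambda>m. if m = 0 then c else 0)"

definition mfps_var :: "'n::finite \<Rightarrow> ('a::comm_ring_1, 'n) mfps" where
  "mfps_var i = Abs_mfps (\<lambda>m. if m = axis i 1 then 1 else 0)"

definition mfps_partial :: "'n::finite \<Rightarrow> ('a::comm_ring_1, 'n) mfps \<Rightarrow> ('a, 'n) mfps" where
  "mfps_partial j f = Abs_mfps (\<lambda>m. of_nat (m $ j + 1) * mfps_nth f (m + axis j 1))"

definition mdeg :: "nat ^ 'n::finite \<Rightarrow> nat" where
  "mdeg m = (\<Sum>i\<in>UNIV. m $ i)"

text \<open>
  Substitution \<open>f(g(z)) = \<Sum>\<^sub>a f\<^sub>a g(z)\<^sup>a\<close>, meaningful only if the components of \<open>g\<close> have no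
  constant term. In that case \<open>g(z)\<^sup>a\<close> has no monomials of degree below \<open>mdeg a\<close>
  (lemma \<open>mfps_nth_monomial_subst_eq_0\<close>), so the truncation loses no terms.
\<close>

definition mfps_compose ::
    "('a::comm_ring_1, 'n::finite) mfps \<Rightarrow> ('a, 'n) mfps ^ 'n \<Rightarrow> ('a, 'n) mfps" where
  "mfps_compose f g = Abs_mfps (\<lambda>m.
     \<Sum>a | mdeg a \<le> mdeg m. mfps_nth f a * mfps_nth (\<Prod>i\<in>UNIV. (g $ i) ^ (a $ i)) m)"

definition mfps_map :: "('a \<Rightarrow> 'b) \<Rightarrow> ('a, 'n::finite) mfps \<Rightarrow> ('b, 'n) mfps" where
  "mfps_map h f = Abs_mfps (\<lambda>m. h (mfps_nth f m))"

definition order_ge :: "('a::comm_ring_1, 'n::finite) mfps ^ 'n \<Rightarrow> nat \<Rightarrow> bool" where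
  "order_ge U k \<longleftrightarrow> (\<forall>i m. mfps_nth (U $ i) m \<noteq> 0 \<longrightarrow> k \<le> mdeg m)"

definition vec_map :: "('a \<Rightarrow> 'b) \<Rightarrow> ('a, 'n::finite) mfps ^ 'n \<Rightarrow> ('b, 'n) mfps ^ 'n" where
  "vec_map h U = (\<chi> i. mfps_map h (U $ i))"

definition vec_compose ::
    "('a::comm_ring_1, 'n::finite) mfps ^ 'n \<Rightarrow> ('a, 'n) mfps ^ 'n \<Rightarrow> ('a, 'n) mfps ^ 'n" where
  "vec_compose U V = (\<chi> i. mfps_compose (U $ i) V)"

definition zvec :: "('a::comm_ring_1, 'n::finite) mfps ^ 'n" where
  "zvec = (\<chi> i. mfps_var i)"

definition jacobian :: "('a::comm_ring_1, 'n::finite) mfps ^ 'n \<Rightarrow> ('a, 'n) mfps ^ 'n ^ 'n" where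
  "jacobian U = (\<chi> i j. mfps_partial j (U $ i))"

definition formal_inverse ::
    "('a::comm_ring_1, 'n::finite) mfps ^ 'n \<Rightarrow> ('a, 'n) mfps ^ 'n \<Rightarrow> bool" where
  "formal_inverse G F \<longleftrightarrow> vec_compose F G = zvec \<and> vec_compose G F = zvec"

text \<open>
  The parameter \<open>t\<close> lives in the coefficients: \<open>\<complex>[t][[z]]\<close> is \<^typ>\<open>(complex poly, 'n::finite) mfps\<close>
  and \<open>\<complex>[[t]][[z]] = \<complex>[[t, z]]\<close> is \<^typ>\<open>(complex fps, 'n::finite) mfps\<close>.
\<close>

definition tpar :: "(complex poly, 'n::finite) mfps" where
  "tpar = mfps_const [:0, 1:]"

definition F_t :: "(complex, 'n::finite) mfps ^ 'n \<Rightarrow> (complex poly, 'n) mfps ^ 'n" where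
  "F_t H = zvec - tpar *s vec_map (\<lambda>c. [:c:]) H"

definition G_t :: "(complex poly, 'n::finite) mfps ^ 'n \<Rightarrow> (complex poly, 'n) mfps ^ 'n" where
  "G_t N = zvec + tpar *s N"

definition cauchy_solution ::
    "(complex, 'n::finite) mfps ^ 'n \<Rightarrow> (complex fps, 'n) mfps ^ 'n \<Rightarrow> bool" where
  "cauchy_solution H U \<longleftrightarrow>
     vec_map fps_deriv U = jacobian U *v U \<and> vec_map (\<lambda>c. fps_nth c 0) U = H"


lemma mdeg_add: "mdeg (a + b) = mdeg a + mdeg b"
  by (simp add: mdeg_def sum.distrib)

lemma mfps_nth_mult_eq_0:
  assumes "\<And>m. mdeg m < k \<Longrightarrow> mfps_nth f m = 0" "\<And>m. mdeg m < l \<Longrightarrow> mfps_nth g m = 0"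
    and "mdeg m < k + l"
  shows "mfps_nth (f * g) m = 0"
proof -
  have "mfps_nth f a * mfps_nth g b = 0" if "a + b = m" for a b
  proof -
    have "mdeg a < k \<or> mdeg b < l"
      using assms(3) mdeg_add[of a b] unfolding that by linarith
    then show ?thesis using assms(1,2) by auto
  qed
  then show ?thesis
    unfolding times_mfps_def mfps_nth_Abs by (intro sum.neutral) auto
qed

lemma mfps_nth_monomial_subst_eq_0:
  fixes g :: "('a::comm_ring_1, 'n::finite) mfps ^ 'n"
  assumes g: "\<And>i. mfps_nth (g $ i) 0 = 0" and "mdeg m < mdeg a"
  shows "mfps_nth (\<Prod>i\<in>UNIV. (g $ i) ^ (a $ i)) m = 0"
proof -
  have pow: "mfps_nth ((g $ i) ^ k) m = 0" if "mdeg m < k" for i k m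
    using that
  proof (induction k arbitrary: m)
    case (Suc k)
    have "mfps_nth (g $ i) m = 0" if "mdeg m < 1" for m
    proof -
      have "m = 0" using that by (auto simp: mdeg_def vec_eq_iff)
      then show ?thesis using g by simp
    qed
    then show ?case
      using Suc mfps_nth_mult_eq_0[of 1 "g $ i" k "(g $ i) ^ k" m] by simp
  qed simp
  have "mfps_nth (\<Prod>i\<in>A. (g $ i) ^ (a $ i)) m = 0" if "mdeg m < (\<Sum>i\<in>A. a $ i)" "finite A" for A m
    using that(2,1)
  proof (induction A arbitrary: m rule: finite_induct)
    case (insert x A)
    have "mfps_nth (g $ x ^ (a $ x) * (\<Prod>i\<in>A. (g $ i) ^ (a $ i))) m = 0"
      by (rule mfps_nth_mult_eq_0[of "a $ x" _ "\<Sum>i\<in>A. a $ i"]) (use insert pow in auto)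
    then show ?case
      using insert.hyps by simp
  qed simp
  then show ?thesis using assms(2) by (simp add: mdeg_def)
qed

end

theory Submission
  imports Defs
begin

text \<open>
  Write \<open>L = \<partial>/\<partial>t - \<Sum>\<^sub>k N\<^sub>k \<partial>/\<partial>z\<^sub>k\<close>. The differential equation of the Cauchy problem says
  \<open>L N\<^sub>i = 0\<close> for all \<open>i\<close>, and the operator \<open>L\<close> is a derivation. For \<open>G = z + t N\<close> the terms
  \<open>L z\<^sub>j = - N\<^sub>j\<close> and \<open>(L t) N\<^sub>j = N\<^sub>j\<close> cancel, which leaves \<open>L G\<^sub>j = t L N\<^sub>j\<close>. By the chain rule
  (\<open>chain_rule\<close>) therefore
  \<open>L (H\<^sub>i(G)) = t \<Sum>\<^sub>j (\<partial>\<^sub>j H\<^sub>i)(G) \<cdot> L N\<^sub>j\<close>.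

  On the other hand \<open>F(G) = z\<close> amounts to \<open>N = H(G)\<close>, because \<open>t\<close> is not a zero divisor. The two
  conditions on \<open>N\<close> are compared through the identity above. If \<open>N = H(G)\<close>, the vector \<open>L N\<close> equals
  \<open>t\<close> times a linear image of itself, so it is divisible by every power of \<open>t\<close> and vanishes.
  Conversely, if \<open>L N = 0\<close>, then \<open>E = N - H(G)\<close> satisfies \<open>L E = 0\<close> and \<open>E = 0\<close> at \<open>t = 0\<close>; this
  linear Cauchy problem has only the solution \<open>0\<close>, since the equation determines the coefficient of
  \<open>t\<^bsup>k+1\<^esup>\<close> from those of lower powers (\<open>linear_cauchy_problem_unique\<close>).

  The other half \<open>G(F) = z\<close> of invertibility amounts to \<open>N(F) = H\<close>. If \<open>L N = 0\<close>, then
  \<open>W = N(F) - H\<close> satisfies \<open>\<partial>W/\<partial>t = JN(F) W\<close> and \<open>W = 0\<close> at \<open>t = 0\<close>, hence \<open>W = 0\<close> by the same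
  uniqueness lemma. That lemma also gives the uniqueness of the solution of the Cauchy problem,
  the difference of two solutions being the solution of a linear problem.

  All this takes place over the coefficient ring \<open>\<complex>[[t]]\<close>, into which \<open>\<complex>[t]\<close> embeds.
\<close>

(* Keeps the exponent vectors axis i 1 in the form in which the lemmas below state them. *)
declare One_nat_def [simp del]

section \<open>Coefficients\<close>

lemma mfps_nth_0 [simp]: "mfps_nth 0 m = 0"
  and mfps_nth_1: "mfps_nth 1 m = (if m = 0 then 1 else 0)"
  and mfps_nth_add [simp]: "mfps_nth (f + g) m = mfps_nth f m + mfps_nth g m"
  and mfps_nth_diff [simp]: "mfps_nth (f - g) m = mfps_nth f m - mfps_nth g m"
  and mfps_nth_mult: "mfps_nth (f * g) m = (\<Sum>(a, b) | a + b = m. mfps_nth f a * mfps_nth g b)"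
  by (simp_all add: zero_mfps_def one_mfps_def plus_mfps_def minus_mfps_def times_mfps_def)

lemma mfps_nth_const: "mfps_nth (mfps_const c) m = (if m = 0 then c else 0)"
  and mfps_nth_var: "mfps_nth (mfps_var i) m = (if m = axis i 1 then 1 else 0)"
  and mfps_nth_partial [simp]:
    "mfps_nth (mfps_partial j f) m = of_nat (m $ j + 1) * mfps_nth f (m + axis j 1)"
  and mfps_nth_map [simp]: "mfps_nth (mfps_map h e) m = h (mfps_nth e m)"
  by (simp_all add: mfps_const_def mfps_var_def mfps_partial_def mfps_map_def)

lemma mfps_nth_sum: "mfps_nth (\<Sum>x\<in>A. f x) m = (\<Sum>x\<in>A. mfps_nth (f x) m)"
  by (induction A rule: infinite_finite_induct) auto

lemma mfps_nth_const_mult [simp]: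
  fixes f :: "('a::comm_ring_1, 'n::finite) mfps"
  shows "mfps_nth (mfps_const c * f) m = c * mfps_nth f m"
proof -
  have "mfps_nth (mfps_const c * f) m =
      (\<Sum>(a, b) \<in> {(0 :: nat ^ 'n, m)}. mfps_nth (mfps_const c) a * mfps_nth f b)"
    unfolding mfps_nth_mult
    by (rule sum.mono_neutral_right) (auto simp: finite_vec_sum_eq mfps_nth_const split: if_splits)
  then show ?thesis by (simp add: mfps_nth_const)
qed

lemma mfps_const_0 [simp]: "mfps_const 0 = 0"
  and mfps_const_1 [simp]: "mfps_const 1 = 1"
  by (simp_all add: mfps_eq_iff mfps_nth_const mfps_nth_1)

lemma mfps_const_add: "mfps_const (c + d) = mfps_const c + mfps_const d"
  and mfps_const_mult: "mfps_const (c * d) = mfps_const c * mfps_const d"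
  by (simp_all add: mfps_eq_iff) (simp_all add: mfps_nth_const)

lemma of_nat_eq_mfps_const: "of_nat k = mfps_const (of_nat k)"
  by (induction k) (simp_all add: mfps_const_add)

lemma mdeg_axis [simp]: "mdeg (axis i 1 :: nat ^ 'n::finite) = 1"
  by (simp add: mdeg_def axis_def)

lemma mdeg_0 [simp]: "mdeg 0 = 0"
  by (simp add: mdeg_def)

lemma mdeg_eq_0_iff: "mdeg m = 0 \<longleftrightarrow> m = 0"
  by (auto simp: mdeg_def vec_eq_iff)

lemma finite_mdeg_le [simp]: "finite {a :: nat ^ 'n::finite. mdeg a \<le> k}"
proof (rule finite_subset[OF _ finite_vec_le[of "\<chi> i. k"]])
  have "a $ i \<le> mdeg a" for a :: "nat ^ 'n" and i
    unfolding mdeg_def by (rule member_le_sum) auto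
  then show "{a :: nat ^ 'n. mdeg a \<le> k} \<subseteq> {a. \<forall>i. a $ i \<le> (\<chi> i. k) $ i}"
    by (auto intro: order_trans)
qed

section \<open>Substitution\<close>

definition subst_monomial ::
    "('a::comm_ring_1, 'n::finite) mfps ^ 'n \<Rightarrow> nat ^ 'n \<Rightarrow> ('a, 'n) mfps" where
  "subst_monomial g a = (\<Prod>i\<in>UNIV. (g $ i) ^ (a $ i))"

lemma subst_monomial_0 [simp]: "subst_monomial g 0 = 1"
  by (simp add: subst_monomial_def)

lemma subst_monomial_add: "subst_monomial g (a + b) = subst_monomial g a * subst_monomial g b"
  by (simp add: subst_monomial_def power_add prod.distrib)

lemma subst_monomial_axis: "subst_monomial g (axis i 1) = g $ i"
proof -
  have "subst_monomial g (axis i 1) = (\<Prod>k\<in>UNIV. if k = i then g $ k else 1)"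
    unfolding subst_monomial_def by (rule prod.cong) (auto simp: axis_def)
  then show ?thesis by simp
qed

lemma mfps_nth_subst_monomial_eq_0:
  assumes "\<And>i. mfps_nth (g $ i) 0 = 0" and "mdeg m < mdeg a"
  shows "mfps_nth (subst_monomial g a) m = 0"
  using mfps_nth_monomial_subst_eq_0[OF assms] by (simp add: subst_monomial_def)

text \<open>
  Composition is given coefficientwise, which is unsuited to algebra. This truncation is a finite sum
  of ring elements with the same coefficients up to degree \<open>k\<close> if \<open>g\<close> has no constant terms, so identities between compositions
  can be proved for it by ring computations.
\<close>

definition compose_upto ::
    "nat \<Rightarrow> ('a::comm_ring_1, 'n::finite) mfps \<Rightarrow> ('a, 'n) mfps ^ 'n \<Rightarrow> ('a, 'n) mfps" where
  "compose_upto k f g = (\<Sum>a | mdeg a \<le> k. mfps_const (mfps_nth f a) * subst_monomial g a)"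

lemma mfps_nth_compose:
  "mfps_nth (mfps_compose f g) m =
    (\<Sum>a | mdeg a \<le> mdeg m. mfps_nth f a * mfps_nth (subst_monomial g a) m)"
  by (simp add: mfps_compose_def subst_monomial_def)

lemma mfps_nth_compose_upto:
  assumes "\<And>i. mfps_nth (g $ i) 0 = 0" and "mdeg m \<le> k"
  shows "mfps_nth (compose_upto k f g) m = mfps_nth (mfps_compose f g) m"
proof -
  have "mfps_nth (mfps_compose f g) m =
    (\<Sum>a | mdeg a \<le> k. mfps_nth f a * mfps_nth (subst_monomial g a) m)"
    unfolding mfps_nth_compose
    by (rule sum.mono_neutral_left)
       (use assms mfps_nth_subst_monomial_eq_0[OF assms(1), of m] in auto)
  then show ?thesis by (simp add: compose_upto_def mfps_nth_sum)
qed

lemma mfps_compose_0 [simp]: "mfps_compose 0 g = 0"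
  by (simp add: mfps_eq_iff mfps_nth_compose)

lemma mfps_compose_add: "mfps_compose (f + h) g = mfps_compose f g + mfps_compose h g"
  and mfps_compose_diff: "mfps_compose (f - h) g = mfps_compose f g - mfps_compose h g"
  by (simp_all add: mfps_eq_iff mfps_nth_compose algebra_simps sum.distrib sum_subtractf)

lemma mfps_compose_sum: "mfps_compose (\<Sum>x\<in>A. f x) g = (\<Sum>x\<in>A. mfps_compose (f x) g)"
  by (induction A rule: infinite_finite_induct) (auto simp: mfps_compose_add)

lemma mfps_compose_const_mult:
  "mfps_compose (mfps_const c * f) g = mfps_const c * mfps_compose f g"
  by (simp add: mfps_eq_iff mfps_nth_compose sum_distrib_left mult.assoc)

lemma mfps_compose_var:
  assumes "mfps_nth (g $ i) 0 = 0"
  shows "mfps_compose (mfps_var i) g = g $ i"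
proof -
  have "mfps_nth (mfps_compose (mfps_var i) g) m = mfps_nth (g $ i) m" for m
  proof -
    have "mfps_nth (mfps_compose (mfps_var i) g) m =
        (\<Sum>a | mdeg a \<le> mdeg m. if a = axis i 1 then mfps_nth (g $ i) m else 0)"
      unfolding mfps_nth_compose by (rule sum.cong) (auto simp: mfps_nth_var subst_monomial_axis)
    moreover have "m = 0" if "\<not> 1 \<le> mdeg m"
      using that mdeg_eq_0_iff[of m] by simp
    ultimately show ?thesis using assms by auto
  qed
  then show ?thesis by (simp add: mfps_eq_iff)
qed

text \<open>
  Up to degree \<open>k\<close>, both sides are the sum of \<open>f\<^sub>a h\<^sub>b g\<^sup>a\<^sup>+\<^sup>b\<close> over the pairs \<open>(a, b)\<close> with \<open>|a + b| \<le> k\<close>: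
  the other pairs in the product of the two truncations contribute only in degrees above \<open>k\<close>.
\<close>

lemma mfps_compose_mult:
  fixes g :: "('a::comm_ring_1, 'n::finite) mfps ^ 'n"
  assumes g: "\<And>i. mfps_nth (g $ i) 0 = 0"
  shows "mfps_compose (f * h) g = mfps_compose f g * mfps_compose h g"
proof -
  have "mfps_nth (mfps_compose (f * h) g) m = mfps_nth (mfps_compose f g * mfps_compose h g) m" for m
  proof -
    define k where "k = mdeg m"
    define B where "B = {a :: nat ^ 'n. mdeg a \<le> k}"
    have fin: "finite B" by (simp add: B_def)
    define t where "t = (\<lambda>(a, b). mfps_nth f a * mfps_nth h b * mfps_nth (subst_monomial g (a + b)) m)"
    have "mfps_nth (mfps_compose f g * mfps_compose h g) m =
        mfps_nth (compose_upto k f g * compose_upto k h g) m"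
      unfolding mfps_nth_mult
    proof (rule sum.cong[OF refl], clarify)
      fix a b assume "m = a + b"
      then have "mdeg a \<le> k" "mdeg b \<le> k" by (simp_all add: k_def mdeg_add)
      then show "mfps_nth (mfps_compose f g) a * mfps_nth (mfps_compose h g) b =
          mfps_nth (compose_upto k f g) a * mfps_nth (compose_upto k h g) b"
        by (simp add: mfps_nth_compose_upto g)
    qed
    also have "compose_upto k f g * compose_upto k h g =
        (\<Sum>(a, b)\<in>B \<times> B. mfps_const (mfps_nth f a * mfps_nth h b) * subst_monomial g (a + b))"
      unfolding compose_upto_def B_def[symmetric] sum_product sum.cartesian_product
      by (rule sum.cong) (auto simp: mfps_const_mult subst_monomial_add algebra_simps)
    also have "mfps_nth \<dots> m = (\<Sum>p\<in>B \<times> B. t p)"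
      by (simp add: mfps_nth_sum t_def case_prod_unfold)
    also have "\<dots> = (\<Sum>p | p \<in> B \<times> B \<and> mdeg (fst p + snd p) \<le> k. t p)"
    proof (intro sum.mono_neutral_right ballI)
      fix p assume "p \<in> B \<times> B - {p. p \<in> B \<times> B \<and> mdeg (fst p + snd p) \<le> k}"
      then have "mdeg m < mdeg (fst p + snd p)" by (auto simp: k_def)
      then show "t p = 0"
        by (simp add: t_def case_prod_unfold mfps_nth_subst_monomial_eq_0 g)
    qed (use fin in auto)
    also have "\<dots> = (\<Sum>(c, p) \<in> Sigma B (\<lambda>c. {(a, b). a + b = c}). t p)"
      by (rule sum.reindex_bij_witness[where i = snd and j = "\<lambda>p. (fst p + snd p, p)"])
         (auto simp: B_def mdeg_add)
    also have "\<dots> = mfps_nth (mfps_compose (f * h) g) m"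
      unfolding mfps_nth_compose
      by (subst sum.Sigma[symmetric])
         (auto simp: mfps_nth_mult sum_distrib_right finite_vec_sum_eq B_def k_def t_def
               intro!: sum.cong)
    finally show ?thesis by simp
  qed
  then show ?thesis by (simp add: mfps_eq_iff)
qed

lemma zvec_nth [simp]: "zvec $ i = mfps_var i"
  by (simp add: zvec_def)

lemma subst_monomial_zvec:
  fixes a m :: "nat ^ 'n::finite"
  shows "mfps_nth (subst_monomial zvec a) m = (if m = a then 1 else 0 :: 'a::comm_ring_1)"
proof (induction "mdeg a" arbitrary: a m)
  case 0
  then have "a = 0" by (simp add: mdeg_eq_0_iff)
  then show ?case by (simp add: mfps_nth_1)
next
  case (Suc k)
  have "\<exists>j. a $ j \<noteq> 0"
  proof (rule ccontr)
    assume "\<nexists>j. a $ j \<noteq> 0"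
    then show False using Suc(2) by (simp add: mdeg_def)
  qed
  then obtain j where "a $ j \<noteq> 0" ..
  then have a: "a = axis j 1 + (a - axis j 1)"
    by (auto simp: vec_eq_iff axis_def)
  define b where "b = a - axis j 1"
  have ab: "a = axis j 1 + b" using a by (simp add: b_def)
  have "k = mdeg b" using Suc(2) by (simp add: ab mdeg_add)
  note IH = Suc(1)[OF this]
  have "mfps_nth (subst_monomial zvec a) m =
      (\<Sum>(c, d) | c + d = m. if c = axis j 1 \<and> d = b then 1 else 0 :: 'a)"
    unfolding ab subst_monomial_add subst_monomial_axis mfps_nth_mult
    by (rule sum.cong) (auto simp: IH mfps_nth_var)
  also have "\<dots> = (\<Sum>p | fst p + snd p = m. if p = (axis j 1, b) then 1 else 0)"
    by (rule sum.cong) (auto split: if_splits)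
  also have "\<dots> = (if m = a then 1 else 0)"
    using finite_vec_sum_eq[of m] by (simp add: ab case_prod_unfold eq_commute)
  finally show ?case .
qed

lemma mfps_compose_zvec [simp]: "mfps_compose f zvec = f"
  by (simp add: mfps_eq_iff mfps_nth_compose subst_monomial_zvec if_distrib[where f = "(*) _"] cong: if_cong)

section \<open>Change of coefficients\<close>

text \<open>
  The two instances used are the embedding of \<open>\<complex>[t]\<close> into \<open>\<complex>[[t]]\<close> and the evaluation at \<open>t = 0\<close>.
\<close>

locale coeff_ring_hom =
  fixes h :: "'a::comm_ring_1 \<Rightarrow> 'b::comm_ring_1"
  assumes add: "h (x + y) = h x + h y"
    and mult: "h (x * y) = h x * h y"
    and one: "h 1 = 1"
begin

lemma zero: "h 0 = 0"
  using add[of 0 0] by simp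

lemma diff: "h (x - y) = h x - h y"
  using add[of "x - y" y] by (simp add: algebra_simps)

lemma sum: "h (\<Sum>x\<in>A. f x) = (\<Sum>x\<in>A. h (f x))"
  by (induction A rule: infinite_finite_induct) (auto simp: add zero)

lemma mfps_map_add: "mfps_map h (f + g) = mfps_map h f + mfps_map h g"
  and mfps_map_diff: "mfps_map h (f - g) = mfps_map h f - mfps_map h g"
  and mfps_map_mult: "mfps_map h (f * g) = mfps_map h f * mfps_map h g"
  and mfps_map_1: "mfps_map h 1 = 1"
  by (auto simp: mfps_eq_iff mfps_nth_mult add diff mult sum mfps_nth_1 one zero intro!: sum.cong)

lemma mfps_map_power: "mfps_map h (f ^ k) = mfps_map h f ^ k"
  by (induction k) (auto simp: mfps_map_mult mfps_map_1)

lemma mfps_map_prod: "mfps_map h (\<Prod>x\<in>A. f x) = (\<Prod>x\<in>A. mfps_map h (f x))"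
  by (induction A rule: infinite_finite_induct) (auto simp: mfps_map_mult mfps_map_1)

lemma mfps_map_const: "mfps_map h (mfps_const c) = mfps_const (h c)"
  and mfps_map_var: "mfps_map h (mfps_var i) = mfps_var i"
  by (simp_all add: mfps_eq_iff mfps_nth_const mfps_nth_var zero one)

lemma mfps_map_compose: "mfps_map h (mfps_compose f g) = mfps_compose (mfps_map h f) (vec_map h g)"
proof -
  have "mfps_map h (subst_monomial g a) = subst_monomial (vec_map h g) a" for a
    by (simp add: subst_monomial_def vec_map_def mfps_map_prod mfps_map_power)
  then have "h (mfps_nth (subst_monomial g a) m) = mfps_nth (subst_monomial (vec_map h g) a) m" for a m
    by (metis mfps_nth_map)
  then show ?thesis
    by (simp add: mfps_eq_iff mfps_nth_compose sum mult)
qed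

lemma vec_map_zvec: "vec_map h zvec = zvec"
  and vec_map_add: "vec_map h (U + V) = vec_map h U + vec_map h V"
  and vec_map_diff: "vec_map h (U - V) = vec_map h U - vec_map h V"
  and vec_map_smult: "vec_map h (f *s U) = mfps_map h f *s vec_map h U"
  by (simp_all add: vec_eq_iff vec_map_def mfps_map_var mfps_map_add mfps_map_diff
      mfps_map_mult)

lemma formal_inverse_vec_map:
  assumes "inj h"
  shows "formal_inverse (vec_map h G) (vec_map h F) \<longleftrightarrow> formal_inverse G F"
proof -
  have inj: "vec_map h U = vec_map h V \<longleftrightarrow> U = V" for U V :: "('a, 'n::finite) mfps ^ 'n"
    using inj_eq[OF assms] by (auto simp: vec_eq_iff vec_map_def mfps_eq_iff)
  have comp: "vec_compose (vec_map h U) (vec_map h V) = vec_map h (vec_compose U V)"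
    for U V :: "('a, 'n) mfps ^ 'n"
    by (simp add: vec_eq_iff vec_compose_def vec_map_def mfps_map_compose[unfolded vec_map_def])
  show ?thesis
    unfolding formal_inverse_def comp by (metis inj vec_map_zvec)
qed

end

section \<open>Derivations and the chain rule\<close>

text \<open>
  A derivation \<open>D\<close> of the series ring that acts on constants by \<open>d\<close>. The last assumption says that
  \<open>D\<close> lowers degrees by at most one. It is a form of continuity, which allows the application of
  \<open>D\<close> to an infinite sum such as a composition to be computed on truncations.
\<close>

locale mfps_derivation =
  fixes D :: "('a::comm_ring_1, 'n::finite) mfps \<Rightarrow> ('a, 'n) mfps" and d :: "'a \<Rightarrow> 'a"
  assumes add: "D (f + g) = D f + D g"
    and mult: "D (f * g) = D f * g + f * D g"
    and const: "D (mfps_const c) = mfps_const (d c)"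
    and local: "(\<And>a. mdeg a \<le> Suc k \<Longrightarrow> mfps_nth f a = mfps_nth g a)
      \<Longrightarrow> mdeg m \<le> k \<Longrightarrow> mfps_nth (D f) m = mfps_nth (D g) m"
begin

lemma zero: "D 0 = 0"
  using add[of 0 0] by simp

lemma diff: "D (f - g) = D f - D g"
  using add[of "f - g" g] by (simp add: algebra_simps)

lemma one: "D 1 = 0"
  using mult[of 1 1] by simp

lemma sum: "D (\<Sum>x\<in>A. f x) = (\<Sum>x\<in>A. D (f x))"
  by (induction A rule: infinite_finite_induct) (auto simp: add zero)

lemma power: "D (f ^ k) = of_nat k * f ^ (k - 1) * D f"
proof (induction k)
  case (Suc k)
  then show ?case
    by (cases k) (auto simp: mult one algebra_simps)
qed (simp add: one)

lemma prod: "finite A \<Longrightarrow> D (\<Prod>x\<in>A. f x) = (\<Sum>x\<in>A. (\<Prod>y\<in>A - {x}. f y) * D (f x))"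
proof (induction A rule: finite_induct)
  case (insert a A)
  have "(\<Prod>y\<in>insert a A - {x}. f y) = f a * (\<Prod>y\<in>A - {x}. f y)" if "x \<in> A" for x
  proof -
    have "insert a A - {x} = insert a (A - {x})" using insert.hyps that by auto
    then show ?thesis using insert.hyps by simp
  qed
  moreover have "insert a A - {a} = A" using insert.hyps by auto
  ultimately show ?case
    using insert by (simp add: mult sum_distrib_left algebra_simps cong: sum.cong)
qed (simp add: one)

lemma subst_monomial:
  "D (subst_monomial g a) =
    (\<Sum>j\<in>UNIV. of_nat (a $ j) * subst_monomial g (a - axis j 1) * D (g $ j))"
proof -
  have "(\<Prod>i\<in>UNIV - {j}. g $ i ^ a $ i) * D (g $ j ^ a $ j) =
      of_nat (a $ j) * subst_monomial g (a - axis j 1) * D (g $ j)" for j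
  proof -
    have "subst_monomial g (a - axis j 1) =
        g $ j ^ ((a - axis j 1) $ j) * (\<Prod>i\<in>UNIV - {j}. g $ i ^ ((a - axis j 1) $ i))"
      unfolding subst_monomial_def by (rule prod.remove) auto
    also have "(\<Prod>i\<in>UNIV - {j}. g $ i ^ ((a - axis j 1) $ i)) = (\<Prod>i\<in>UNIV - {j}. g $ i ^ a $ i)"
      by (rule prod.cong) (auto simp: axis_def)
    finally show ?thesis by (simp add: power algebra_simps axis_def)
  qed
  then show ?thesis by (simp add: subst_monomial_def prod)
qed

lemma compose_upto:
  "D (compose_upto (Suc k) f g) = compose_upto (Suc k) (mfps_map d f) g
    + (\<Sum>j\<in>UNIV. compose_upto k (mfps_partial j f) g * D (g $ j))"
proof -
  let ?B = "{a :: nat ^ 'n. mdeg a \<le> Suc k}"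
  have shift: "(\<Sum>a\<in>?B. mfps_const (mfps_nth f a) * (of_nat (a $ j) * subst_monomial g (a - axis j 1)))
      = compose_upto k (mfps_partial j f) g" for j
  proof -
    have "(\<Sum>a\<in>?B. mfps_const (mfps_nth f a) * (of_nat (a $ j) * subst_monomial g (a - axis j 1)))
      = (\<Sum>a | a \<in> ?B \<and> a $ j \<noteq> 0.
          mfps_const (mfps_nth f a) * (of_nat (a $ j) * subst_monomial g (a - axis j 1)))"
      by (rule sum.mono_neutral_right) auto
    also have "\<dots> = compose_upto k (mfps_partial j f) g"
      unfolding compose_upto_def
    proof (rule sum.reindex_bij_witness[where i = "\<lambda>b. b + axis j 1" and j = "\<lambda>a. a - axis j 1"])
      fix a :: "nat ^ 'n" assume "a \<in> {a. a \<in> ?B \<and> a $ j \<noteq> 0}"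
      then have a: "a - axis j 1 + axis j 1 = a" and deg: "mdeg a \<le> Suc k"
        by (auto simp: vec_eq_iff axis_def)
      show "a - axis j 1 + axis j 1 = a" by (fact a)
      have "mdeg a = mdeg (a - axis j 1) + 1"
        by (subst a[symmetric]) (simp only: mdeg_add mdeg_axis)
      then show "a - axis j 1 \<in> {a. mdeg a \<le> k}" using deg by simp
      have "(a - axis j 1) $ j + 1 = a $ j"
        by (metis a axis_nth vector_add_component)
      then have "mfps_nth (mfps_partial j f) (a - axis j 1) = of_nat (a $ j) * mfps_nth f a"
        unfolding mfps_nth_partial a by (simp only:)
      then show "mfps_const (mfps_nth (mfps_partial j f) (a - axis j 1)) * subst_monomial g (a - axis j 1)
          = mfps_const (mfps_nth f a) * (of_nat (a $ j) * subst_monomial g (a - axis j 1))"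
        by (simp only: mfps_const_mult of_nat_eq_mfps_const) (simp add: algebra_simps)
    next
      fix b :: "nat ^ 'n" assume "b \<in> {a. mdeg a \<le> k}"
      then show "b + axis j 1 \<in> {a. a \<in> ?B \<and> a $ j \<noteq> 0}"
        by (simp add: mdeg_add)
    qed (auto simp: vec_eq_iff)
    finally show ?thesis .
  qed
  have "D (compose_upto (Suc k) f g) =
      (\<Sum>a\<in>?B. mfps_const (d (mfps_nth f a)) * subst_monomial g a)
      + (\<Sum>a\<in>?B. \<Sum>j\<in>UNIV. mfps_const (mfps_nth f a)
          * (of_nat (a $ j) * subst_monomial g (a - axis j 1)) * D (g $ j))"
    by (simp add: compose_upto_def sum mult const subst_monomial sum.distrib sum_distrib_left
        mult.assoc)
  also have "(\<Sum>a\<in>?B. mfps_const (d (mfps_nth f a)) * subst_monomial g a) =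
      compose_upto (Suc k) (mfps_map d f) g"
    by (simp add: compose_upto_def)
  also have "(\<Sum>a\<in>?B. \<Sum>j\<in>UNIV. mfps_const (mfps_nth f a)
          * (of_nat (a $ j) * subst_monomial g (a - axis j 1)) * D (g $ j))
      = (\<Sum>j\<in>UNIV. compose_upto k (mfps_partial j f) g * D (g $ j))"
    by (subst sum.swap) (simp add: shift[symmetric] sum_distrib_right)
  finally show ?thesis .
qed

text \<open>
  For a truncation this is the product rule on monomials, with the index shift \<open>a \<mapsto> a - e\<^sub>j\<close> turning
  \<open>a\<^sub>j f\<^sub>a\<close> into a coefficient of \<open>\<partial>\<^sub>j f\<close>.
\<close>

theorem chain_rule:
  assumes g: "\<And>i. mfps_nth (g $ i) 0 = 0"
  shows "D (mfps_compose f g) = mfps_compose (mfps_map d f) g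
    + (\<Sum>j\<in>UNIV. mfps_compose (mfps_partial j f) g * D (g $ j))"
proof -
  have "mfps_nth (D (mfps_compose f g)) m = mfps_nth (mfps_compose (mfps_map d f) g
    + (\<Sum>j\<in>UNIV. mfps_compose (mfps_partial j f) g * D (g $ j))) m" for m
  proof -
    define k where "k = mdeg m"
    have "mfps_nth (D (mfps_compose f g)) m = mfps_nth (D (compose_upto (Suc k) f g)) m"
      \<comment> \<open>The truncation is taken one degree further than \<open>m\<close>, as \<open>D\<close> may lower degrees by one.\<close>
      by (rule local[where k = k]) (auto simp: mfps_nth_compose_upto g k_def)
    also have "\<dots> = mfps_nth (compose_upto (Suc k) (mfps_map d f) g) m
        + (\<Sum>j\<in>UNIV. mfps_nth (compose_upto k (mfps_partial j f) g * D (g $ j)) m)"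
      by (simp add: compose_upto mfps_nth_sum)
    also have "\<dots> = mfps_nth (mfps_compose (mfps_map d f) g) m
        + (\<Sum>j\<in>UNIV. mfps_nth (mfps_compose (mfps_partial j f) g * D (g $ j)) m)"
    proof (intro arg_cong2[where f = "(+)"] sum.cong refl)
      show "mfps_nth (compose_upto (Suc k) (mfps_map d f) g) m
          = mfps_nth (mfps_compose (mfps_map d f) g) m"
        by (rule mfps_nth_compose_upto[OF g]) (simp add: k_def)
      show "mfps_nth (compose_upto k (mfps_partial j f) g * D (g $ j)) m
          = mfps_nth (mfps_compose (mfps_partial j f) g * D (g $ j)) m" for j
        unfolding mfps_nth_mult
        by (rule sum.cong) (auto simp: k_def mdeg_add mfps_nth_compose_upto g)
    qed
    finally show ?thesis by (simp add: mfps_nth_sum)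
  qed
  then show ?thesis by (simp add: mfps_eq_iff)
qed

end

lemma mfps_partial_add: "mfps_partial j (f + g) = mfps_partial j f + mfps_partial j g"
  and mfps_partial_diff: "mfps_partial j (f - g) = mfps_partial j f - mfps_partial j g"
  by (simp_all add: mfps_eq_iff algebra_simps)

lemma mfps_partial_const [simp]:
  fixes j :: "'n::finite"
  shows "mfps_partial j (mfps_const c) = 0"
proof -
  have "m + axis j 1 \<noteq> 0" for m :: "nat ^ 'n"
    by (metis add_is_0 axis_nth one_neq_zero vector_add_component zero_index)
  then show ?thesis by (simp add: mfps_eq_iff mfps_nth_const)
qed

lemma mfps_partial_var:
  fixes j :: "'n::finite"
  shows "mfps_partial j (mfps_var i) = (if i = j then 1 else 0)"
proof -
  have "m + axis j 1 = axis i 1 \<longleftrightarrow> i = j \<and> m = 0" for m :: "nat ^ 'n"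
  proof
    assume eq: "m + axis j 1 = axis i 1"
    then have "m $ j + 1 = axis i 1 $ j"
      by (metis axis_nth vector_add_component)
    then have "i = j" by (simp add: axis_def split: if_splits)
    then show "i = j \<and> m = 0" using eq by simp
  qed auto
  then show ?thesis by (auto simp: mfps_eq_iff mfps_nth_var mfps_nth_1)
qed

text \<open>
  On the coefficient of \<open>z\<^sup>m\<close>, the factor \<open>m\<^sub>j + 1\<close> is distributed as \<open>a\<^sub>j + b\<^sub>j\<close> over the pairs with
  \<open>a + b = m + e\<^sub>j\<close>; each half is one term of the product rule after an index shift.
\<close>

lemma mfps_partial_mult:
  fixes f g :: "('a::comm_ring_1, 'n::finite) mfps"
  shows "mfps_partial j (f * g) = mfps_partial j f * g + f * mfps_partial j g"
proof -
  have half: "(\<Sum>(a, b) | a + b = m + axis j 1. of_nat (a $ j) * mfps_nth f a * mfps_nth g b)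
      = mfps_nth (mfps_partial j f * g) m" for m and f g :: "('a, 'n) mfps"
  proof -
    have "(\<Sum>(a, b) | a + b = m + axis j 1. of_nat (a $ j) * mfps_nth f a * mfps_nth g b)
        = (\<Sum>(a, b) | a + b = m + axis j 1 \<and> a $ j \<noteq> 0. of_nat (a $ j) * mfps_nth f a * mfps_nth g b)"
      by (rule sum.mono_neutral_right) (auto simp: finite_vec_sum_eq intro!: gr0I)
    also have "\<dots> = mfps_nth (mfps_partial j f * g) m"
      unfolding mfps_nth_mult
    proof (rule sum.reindex_bij_witness
        [where i = "\<lambda>(a, b). (a + axis j 1, b)" and j = "\<lambda>(a, b). (a - axis j 1, b)"])
      fix p assume p: "p \<in> {(a, b). a + b = m + axis j 1 \<and> a $ j \<noteq> 0}"
      obtain a b where p_eq: "p = (a, b)" by fastforce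
      have a: "a - axis j 1 + axis j 1 = a"
        using p by (auto simp: p_eq vec_eq_iff axis_def)
      show "(case case p of (a, b) \<Rightarrow> (a - axis j 1, b) of (a, b) \<Rightarrow> (a + axis j 1, b)) = p"
        by (simp add: p_eq a)
      have "a - axis j 1 + b + axis j 1 = a - axis j 1 + axis j 1 + b"
        by (simp only: ac_simps)
      then have "a - axis j 1 + b + axis j 1 = m + axis j 1"
        using p by (simp add: a p_eq)
      then show "(case p of (a, b) \<Rightarrow> (a - axis j 1, b)) \<in> {(a, b). a + b = m}"
        by (simp add: p_eq)
      have "(a - axis j 1) $ j + 1 = a $ j"
        by (metis a axis_nth vector_add_component)
      then have "mfps_nth (mfps_partial j f) (a - axis j 1) = of_nat (a $ j) * mfps_nth f a"
        unfolding mfps_nth_partial a by (simp only:)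
      then show "(case case p of (a, b) \<Rightarrow> (a - axis j 1, b) of
            (a, b) \<Rightarrow> mfps_nth (mfps_partial j f) a * mfps_nth g b) =
          (case p of (a, b) \<Rightarrow> of_nat (a $ j) * mfps_nth f a * mfps_nth g b)"
        by (simp add: p_eq del: mfps_nth_partial)
    qed (auto simp: algebra_simps)
    finally show ?thesis .
  qed
  have "mfps_nth (mfps_partial j (f * g)) m =
      mfps_nth (mfps_partial j f * g + f * mfps_partial j g) m" for m
  proof -
    have "mfps_nth (mfps_partial j (f * g)) m
        = (\<Sum>(a, b) | a + b = m + axis j 1. of_nat (m $ j + 1) * (mfps_nth f a * mfps_nth g b))"
      unfolding mfps_nth_partial mfps_nth_mult sum_distrib_left by (simp add: case_prod_unfold)
    also have "\<dots> = (\<Sum>(a, b) | a + b = m + axis j 1.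
        of_nat (a $ j) * mfps_nth f a * mfps_nth g b + of_nat (b $ j) * mfps_nth g b * mfps_nth f a)"
    proof (rule sum.cong[OF refl], clarify)
      fix a b assume "a + b = m + axis j 1"
      then have "m $ j + 1 = a $ j + b $ j"
        by (metis axis_nth vector_add_component)
      then show "of_nat (m $ j + 1) * (mfps_nth f a * mfps_nth g b) =
          of_nat (a $ j) * mfps_nth f a * mfps_nth g b + of_nat (b $ j) * mfps_nth g b * mfps_nth f a"
        by (simp only: of_nat_add) (simp add: algebra_simps)
    qed
    also have "\<dots> = (\<Sum>(a, b) | a + b = m + axis j 1. of_nat (a $ j) * mfps_nth f a * mfps_nth g b)
        + (\<Sum>(a, b) | a + b = m + axis j 1. of_nat (b $ j) * mfps_nth g b * mfps_nth f a)"
      by (simp add: case_prod_unfold sum.distrib)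
    also have "(\<Sum>(a, b) | a + b = m + axis j 1. of_nat (b $ j) * mfps_nth g b * mfps_nth f a)
        = (\<Sum>(b, a) | b + a = m + axis j 1. of_nat (b $ j) * mfps_nth g b * mfps_nth f a)"
      by (rule sum.reindex_bij_witness[where i = prod.swap and j = prod.swap])
         (auto simp: add.commute)
    finally show ?thesis
      unfolding half mfps_nth_add by (simp only: mult.commute)
  qed
  then show ?thesis by (simp add: mfps_eq_iff)
qed

lemma mfps_map_fps_deriv_add:
    "mfps_map fps_deriv (f + g) = mfps_map fps_deriv f + mfps_map fps_deriv g"
  and mfps_map_fps_deriv_diff:
    "mfps_map fps_deriv (f - g) = mfps_map fps_deriv f - mfps_map fps_deriv g"
  by (simp_all add: mfps_eq_iff)

lemma mfps_map_fps_deriv_mult: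
  "mfps_map fps_deriv (f * g) = mfps_map fps_deriv f * g + f * mfps_map fps_deriv g"
  by (simp add: mfps_eq_iff mfps_nth_mult fps_deriv_sum case_prod_unfold flip: sum.distrib)
     (simp add: add.commute)

lemma mfps_map_fps_deriv_const: "mfps_map fps_deriv (mfps_const c) = mfps_const (fps_deriv c)"
  and mfps_map_fps_deriv_var: "mfps_map fps_deriv (mfps_var i) = 0"
  by (simp_all add: mfps_eq_iff mfps_nth_const mfps_nth_var)

text \<open>
  The derivative along the vector field \<open>\<partial>/\<partial>t - \<Sum>\<^sub>j V\<^sub>j \<partial>/\<partial>z\<^sub>j\<close>, called \<open>L\<close> above when \<open>V = N\<close>.
\<close>

definition transport_deriv ::
    "('a::comm_ring_1 fps, 'n::finite) mfps ^ 'n \<Rightarrow> ('a fps, 'n) mfps \<Rightarrow> ('a fps, 'n) mfps" where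
  "transport_deriv V f = mfps_map fps_deriv f - (\<Sum>j\<in>UNIV. mfps_partial j f * V $ j)"

lemma mfps_derivation_transport: "mfps_derivation (transport_deriv V) fps_deriv"
proof
  fix f g :: "('a fps, 'b) mfps" and c :: "'a fps" and k and m :: "nat ^ 'b"
  show "transport_deriv V (f + g) = transport_deriv V f + transport_deriv V g"
    by (simp add: transport_deriv_def mfps_map_fps_deriv_add mfps_partial_add algebra_simps
        sum.distrib)
  show "transport_deriv V (f * g) = transport_deriv V f * g + f * transport_deriv V g"
    by (simp add: transport_deriv_def mfps_map_fps_deriv_mult mfps_partial_mult algebra_simps
        sum.distrib sum_distrib_left)
  show "transport_deriv V (mfps_const c) = mfps_const (fps_deriv c)"
    by (simp add: transport_deriv_def mfps_map_fps_deriv_const)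
  assume eq: "\<And>a. mdeg a \<le> Suc k \<Longrightarrow> mfps_nth f a = mfps_nth g a" and m: "mdeg m \<le> k"
  have "mfps_nth (mfps_partial j f * V $ j) m = mfps_nth (mfps_partial j g * V $ j) m" for j
    unfolding mfps_nth_mult
    by (rule sum.cong) (use m in \<open>auto simp: mdeg_add eq\<close>)
  then show "mfps_nth (transport_deriv V f) m = mfps_nth (transport_deriv V g) m"
    using m by (simp add: transport_deriv_def mfps_nth_sum eq)
qed

section \<open>The order in the parameter\<close>

text \<open>
  Divisibility by \<open>t\<^sup>k\<close>, in terms of coefficients.
\<close>

definition t_order_ge :: "nat \<Rightarrow> ('a::comm_ring_1 fps, 'n::finite) mfps \<Rightarrow> bool" where
  "t_order_ge k f \<longleftrightarrow> (\<forall>m. \<forall>l<k. fps_nth (mfps_nth f m) l = 0)"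

lemma eq_0_if_t_order_ge: "(\<And>k. t_order_ge k f) \<Longrightarrow> f = 0"
  by (auto simp: t_order_ge_def mfps_eq_iff fps_eq_iff)

lemma t_order_ge_sum: "(\<And>x. x \<in> A \<Longrightarrow> t_order_ge k (f x)) \<Longrightarrow> t_order_ge k (\<Sum>x\<in>A. f x)"
  by (auto simp: t_order_ge_def mfps_nth_sum fps_sum_nth)

lemma t_order_ge_add: "t_order_ge k f \<Longrightarrow> t_order_ge k g \<Longrightarrow> t_order_ge k (f + g)"
  by (auto simp: t_order_ge_def)

lemma t_order_ge_mult: "t_order_ge k f \<Longrightarrow> t_order_ge k (g * f)"
  unfolding t_order_ge_def mfps_nth_mult fps_sum_nth
  by (auto simp: fps_sum_nth fps_mult_nth intro!: sum.neutral)

lemma t_order_ge_partial: "t_order_ge k f \<Longrightarrow> t_order_ge k (mfps_partial j f)"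
  by (auto simp: t_order_ge_def fps_mult_nth)

lemma t_order_ge_X_mult: "t_order_ge k f \<Longrightarrow> t_order_ge (Suc k) (mfps_const fps_X * f)"
  by (auto simp: t_order_ge_def)

text \<open>
  The coefficient of \<open>t\<^sup>l\<close> in the derivative is \<open>l + 1\<close> times the next coefficient of \<open>f\<close>, and
  \<open>l + 1\<close> can be cancelled in characteristic zero.
\<close>

lemma t_order_ge_integrate:
  fixes f :: "('a::{idom,ring_char_0} fps, 'n::finite) mfps"
  assumes "mfps_map (\<lambda>c. fps_nth c 0) f = 0" and "t_order_ge k (mfps_map fps_deriv f)"
  shows "t_order_ge (Suc k) f"
  unfolding t_order_ge_def
proof (intro allI impI)
  fix m l assume "l < Suc k"
  show "fps_nth (mfps_nth f m) l = 0"
  proof (cases l)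
    case 0
    then show ?thesis using assms(1) by (metis mfps_nth_0 mfps_nth_map)
  next
    case (Suc l')
    then have "fps_nth (fps_deriv (mfps_nth f m)) l' = 0"
      using assms(2) \<open>l < Suc k\<close> by (simp add: t_order_ge_def)
    then have "of_nat (Suc l') * fps_nth (mfps_nth f m) (Suc l') = 0"
      by (simp only: fps_deriv_nth Suc_eq_plus1)
    then show ?thesis
      using Suc by (metis mult_eq_0_iff of_nat_neq_0)
  qed
qed

text \<open>
  The right-hand side of the equation does not involve \<open>\<partial>/\<partial>t\<close>, so it preserves divisibility by
  \<open>t\<^sup>k\<close>; integration in \<open>t\<close> then raises the order of \<open>W\<close> to \<open>k + 1\<close>.
\<close>

lemma linear_cauchy_problem_unique:
  fixes W :: "'i \<Rightarrow> ('a::{idom,ring_char_0} fps, 'n::finite) mfps"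
  assumes deriv: "\<And>i. i \<in> I \<Longrightarrow> mfps_map fps_deriv (W i) =
      (\<Sum>j\<in>I. A i j * W j) + (\<Sum>j\<in>UNIV. B i j * mfps_partial j (W i))"
    and init: "\<And>i. i \<in> I \<Longrightarrow> mfps_map (\<lambda>c. fps_nth c 0) (W i) = 0"
    and "i \<in> I"
  shows "W i = 0"
proof -
  have "\<forall>i\<in>I. t_order_ge k (W i)" for k
  proof (induction k)
    case 0
    then show ?case by (simp add: t_order_ge_def)
  next
    case (Suc k)
    then show ?case
      by (auto intro!: t_order_ge_integrate t_order_ge_add t_order_ge_sum t_order_ge_mult
          t_order_ge_partial init simp: deriv)
  qed
  then show ?thesis using \<open>i \<in> I\<close> by (blast intro: eq_0_if_t_order_ge)
qed

lemma fixed_point_X_mult_eq_0: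
  assumes "\<And>i. i \<in> I \<Longrightarrow> W i = mfps_const fps_X * (\<Sum>j\<in>I. A i j * W j)" and "i \<in> I"
  shows "W i = 0"
proof -
  have "\<forall>i\<in>I. t_order_ge k (W i)" for k
  proof (induction k)
    case 0
    then show ?case by (simp add: t_order_ge_def)
  next
    case (Suc k)
    then show ?case
      by (metis (no_types, lifting) assms(1) t_order_ge_X_mult t_order_ge_sum t_order_ge_mult)
  qed
  then show ?thesis using \<open>i \<in> I\<close> by (blast intro: eq_0_if_t_order_ge)
qed

section \<open>Inversion over formal power series in the parameter\<close>

abbreviation fps_tpar :: "('a::comm_ring_1 fps, 'n::finite) mfps" where
  "fps_tpar \<equiv> mfps_const fps_X"

lemma cauchy_solution_iff:
  "cauchy_solution H U \<longleftrightarrow>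
    (\<forall>i. transport_deriv U (U $ i) = 0) \<and> (\<forall>i. mfps_map (\<lambda>c. fps_nth c 0) (U $ i) = H $ i)"
  by (simp add: cauchy_solution_def vec_eq_iff vec_map_def jacobian_def matrix_vector_mult_def
      transport_deriv_def)

lemma coeff_ring_hom_fps_of_poly: "coeff_ring_hom fps_of_poly"
  by standard (simp_all add: fps_of_poly_add fps_of_poly_mult)

lemma coeff_ring_hom_fps_nth_0: "coeff_ring_hom (\<lambda>c :: 'a::comm_ring_1 fps. fps_nth c 0)"
  by standard simp_all

text \<open>
  From \<open>JU U - JV V = J(U - V) U + JV (U - V)\<close>, the difference \<open>U - V\<close> solves a homogeneous linear
  Cauchy problem with zero initial value.
\<close>

lemma cauchy_solution_unique:
  assumes U: "cauchy_solution H U" and V: "cauchy_solution H V"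
  shows "U = V"
proof -
  have "U $ i - V $ i = 0" for i
  proof (rule linear_cauchy_problem_unique[where I = UNIV and W = "\<lambda>i. U $ i - V $ i"
        and A = "\<lambda>i j. mfps_partial j (V $ i)" and B = "\<lambda>i j. U $ j"])
    fix i
    have eqs: "mfps_map fps_deriv (U $ i) = (\<Sum>j\<in>UNIV. mfps_partial j (U $ i) * U $ j)"
      "mfps_map fps_deriv (V $ i) = (\<Sum>j\<in>UNIV. mfps_partial j (V $ i) * V $ j)"
      using U V by (simp_all add: cauchy_solution_iff transport_deriv_def)
    show "mfps_map fps_deriv (U $ i - V $ i) =
        (\<Sum>j\<in>UNIV. mfps_partial j (V $ i) * (U $ j - V $ j))
        + (\<Sum>j\<in>UNIV. U $ j * mfps_partial j (U $ i - V $ i))"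
      by (simp add: mfps_map_fps_deriv_diff eqs mfps_partial_diff algebra_simps sum_subtractf)
    show "mfps_map (\<lambda>c. fps_nth c 0) (U $ i - V $ i) = 0"
      using U V by (simp add: coeff_ring_hom.mfps_map_diff[OF coeff_ring_hom_fps_nth_0]
          cauchy_solution_iff)
  qed auto
  then show ?thesis by (simp add: vec_eq_iff)
qed

text \<open>
  Here \<open>N\<close> is a series in both \<open>t\<close> and \<open>z\<close>, and \<open>H'\<close> is \<open>H\<close> regarded as constant in \<open>t\<close>. The
  constant terms (in \<open>z\<close>) vanish so that \<open>G\<close> and \<open>F\<close> can be substituted into series.
\<close>

context
  fixes H :: "(complex, 'n::finite) mfps ^ 'n" and N G F :: "(complex fps, 'n) mfps ^ 'n"
    and H' :: "(complex fps, 'n) mfps ^ 'n"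
  assumes N0: "\<And>i. mfps_nth (N $ i) 0 = 0" and H0: "\<And>i. mfps_nth (H $ i) 0 = 0"
  defines "H' \<equiv> vec_map fps_const H"
  defines "G \<equiv> zvec + fps_tpar *s N" and "F \<equiv> zvec - fps_tpar *s H'"
begin

interpretation ev: coeff_ring_hom "\<lambda>c :: complex fps. fps_nth c 0"
  by (rule coeff_ring_hom_fps_nth_0)

interpretation L: mfps_derivation "transport_deriv N" fps_deriv
  by (rule mfps_derivation_transport)

lemma axis_neq_0: "axis i (1::nat) \<noteq> (0 :: nat ^ 'n)"
  by (metis mdeg_axis mdeg_0 one_neq_zero)

lemma G_nth: "G $ i = mfps_var i + fps_tpar * N $ i"
  and F_nth: "F $ i = mfps_var i - fps_tpar * H' $ i"
  by (simp_all add: G_def F_def)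

lemma G_0: "mfps_nth (G $ i) 0 = 0" and F_0: "mfps_nth (F $ i) 0 = 0"
  using axis_neq_0[of i] by (simp_all add: G_nth F_nth N0 H0 mfps_nth_var H'_def vec_map_def)

lemma ev_H': "mfps_map (\<lambda>c. fps_nth c 0) (H' $ i) = H $ i"
  by (simp add: vec_map_def H'_def mfps_eq_iff)

lemma ev_fps_tpar: "mfps_map (\<lambda>c :: complex fps. fps_nth c 0) fps_tpar = 0"
  by (simp add: ev.mfps_map_const)

lemma ev_G: "vec_map (\<lambda>c. fps_nth c 0) G = zvec" and ev_F: "vec_map (\<lambda>c. fps_nth c 0) F = zvec"
  by (simp_all add: G_def F_def ev.vec_map_add ev.vec_map_diff ev.vec_map_smult ev.vec_map_zvec
      ev_fps_tpar)

lemma deriv_H': "mfps_map fps_deriv (H' $ i) = 0"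
  by (simp add: H'_def vec_map_def mfps_eq_iff)

text \<open>
  The contributions \<open>- N\<^sub>j\<close> of \<open>z\<^sub>j\<close> and \<open>N\<^sub>j\<close> of the explicit factor \<open>t\<close> cancel.
\<close>

lemma transport_G: "transport_deriv N (G $ j) = fps_tpar * transport_deriv N (N $ j)"
proof -
  have "transport_deriv N (mfps_var j) = - N $ j"
    by (simp add: transport_deriv_def mfps_map_fps_deriv_var mfps_partial_var mult_delta_left)
  then show ?thesis by (simp add: G_nth L.add L.mult L.const)
qed

lemma transport_compose_G:
  "transport_deriv N (mfps_compose (H' $ i) G) =
    fps_tpar * (\<Sum>j\<in>UNIV. mfps_compose (mfps_partial j (H' $ i)) G * transport_deriv N (N $ j))"
  by (simp add: L.chain_rule[OF G_0] deriv_H' transport_G sum_distrib_left algebra_simps)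

lemma ev_compose_G: "mfps_map (\<lambda>c. fps_nth c 0) (mfps_compose (H' $ i) G) = H $ i"
  by (simp add: ev.mfps_map_compose ev_G ev_H')

text \<open>
  The functional equation expresses \<open>F(G) = z\<close>. Both directions rest on \<open>transport_compose_G\<close>, which
  makes \<open>L N\<close> a multiple of \<open>t\<close> in the first direction and turns \<open>L N = 0\<close> into \<open>L (N - H(G)) = 0\<close>
  in the second.
\<close>

lemma cauchy_solution_iff_functional_equation:
  "cauchy_solution H N \<longleftrightarrow> (\<forall>i. N $ i = mfps_compose (H' $ i) G)"
proof
  assume eq: "\<forall>i. N $ i = mfps_compose (H' $ i) G"
  have "transport_deriv N (N $ i) = 0" for i
  proof (rule fixed_point_X_mult_eq_0[where I = UNIV and W = "\<lambda>i. transport_deriv N (N $ i)"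
        and A = "\<lambda>i j. mfps_compose (mfps_partial j (H' $ i)) G"])
    show "transport_deriv N (N $ i) = fps_tpar *
        (\<Sum>j\<in>UNIV. mfps_compose (mfps_partial j (H' $ i)) G * transport_deriv N (N $ j))" for i
      using transport_compose_G[of i] eq by (metis (no_types))
  qed auto
  moreover have "mfps_map (\<lambda>c. fps_nth c 0) (N $ i) = H $ i" for i
    using ev_compose_G[of i] eq by (metis (no_types))
  ultimately show "cauchy_solution H N"
    by (simp add: cauchy_solution_iff)
next
  assume sol: "cauchy_solution H N"
  have "N $ i - mfps_compose (H' $ i) G = 0" for i
  proof (rule linear_cauchy_problem_unique[where I = UNIV
        and W = "\<lambda>i. N $ i - mfps_compose (H' $ i) G" and A = "\<lambda>i j. 0" and B = "\<lambda>i j. N $ j"])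
    fix i
    have "transport_deriv N (N $ i - mfps_compose (H' $ i) G) = 0"
      using sol by (simp add: L.diff transport_compose_G cauchy_solution_iff)
    then show "mfps_map fps_deriv (N $ i - mfps_compose (H' $ i) G) =
        (\<Sum>j\<in>UNIV. 0 * (N $ j - mfps_compose (H' $ j) G))
        + (\<Sum>j\<in>UNIV. N $ j * mfps_partial j (N $ i - mfps_compose (H' $ i) G))"
      by (simp add: transport_deriv_def mult.commute)
    show "mfps_map (\<lambda>c. fps_nth c 0) (N $ i - mfps_compose (H' $ i) G) = 0"
      using sol by (simp add: ev.mfps_map_diff ev_compose_G cauchy_solution_iff)
  qed auto
  then show "\<forall>i. N $ i = mfps_compose (H' $ i) G" by simp
qed

lemma compose_F_G: "mfps_compose (F $ i) G = G $ i - fps_tpar * mfps_compose (H' $ i) G"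
  by (simp add: F_nth mfps_compose_diff mfps_compose_const_mult mfps_compose_var G_0)

lemma compose_G_F: "mfps_compose (G $ i) F = F $ i + fps_tpar * mfps_compose (N $ i) F"
  by (simp add: G_nth mfps_compose_add mfps_compose_const_mult mfps_compose_var F_0)

text \<open>
  Since \<open>\<partial>F/\<partial>t = - H\<close>, the chain rule and the differential equation give
  \<open>\<partial>(N(F))/\<partial>t = (JN N)(F) - JN(F) H = JN(F) (N(F) - H)\<close>, a linear equation for \<open>N(F) - H\<close>.
\<close>

lemma compose_N_F:
  assumes sol: "cauchy_solution H N"
  shows "mfps_compose (N $ i) F = H' $ i"
proof -
  \<comment> \<open>Along the zero vector field, the transport derivative is \<open>\<partial>/\<partial>t\<close>.\<close>
  interpret D: mfps_derivation "transport_deriv 0" "fps_deriv :: complex fps \<Rightarrow> _"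
    by (rule mfps_derivation_transport)
  have D_eq: "transport_deriv 0 f = mfps_map fps_deriv f" for f :: "(complex fps, 'n) mfps"
    by (simp add: transport_deriv_def)
  note chain = D.chain_rule[OF F_0, unfolded D_eq]
  have deriv_F: "mfps_map fps_deriv (F $ j) = - H' $ j" for j
    by (simp add: F_nth mfps_map_fps_deriv_diff mfps_map_fps_deriv_mult mfps_map_fps_deriv_const
        mfps_map_fps_deriv_var deriv_H')
  have "mfps_compose (N $ i) F - H' $ i = 0"
  proof (rule linear_cauchy_problem_unique[where I = UNIV
        and W = "\<lambda>i. mfps_compose (N $ i) F - H' $ i"
        and A = "\<lambda>i j. mfps_compose (mfps_partial j (N $ i)) F" and B = "\<lambda>i j. 0"])
    fix i
    have "mfps_map fps_deriv (N $ i) = (\<Sum>j\<in>UNIV. mfps_partial j (N $ i) * N $ j)"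
      using sol by (simp add: cauchy_solution_iff transport_deriv_def)
    then show "mfps_map fps_deriv (mfps_compose (N $ i) F - H' $ i) =
        (\<Sum>j\<in>UNIV. mfps_compose (mfps_partial j (N $ i)) F * (mfps_compose (N $ j) F - H' $ j))
        + (\<Sum>j\<in>UNIV. 0 * mfps_partial j (mfps_compose (N $ i) F - H' $ i))"
      by (simp add: mfps_map_fps_deriv_diff chain deriv_F deriv_H' mfps_compose_sum
          mfps_compose_mult[OF F_0] algebra_simps sum_subtractf sum_negf)
    show "mfps_map (\<lambda>c. fps_nth c 0) (mfps_compose (N $ i) F - H' $ i) = 0"
      using sol
      by (simp add: ev.mfps_map_diff ev.mfps_map_compose ev_F ev_H' cauchy_solution_iff)
  qed auto
  then show ?thesis by simp
qed

lemma formal_inverse_iff_cauchy_solution: "formal_inverse G F \<longleftrightarrow> cauchy_solution H N"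
proof
  assume "formal_inverse G F"
  then have "mfps_compose (F $ i) G = mfps_var i" for i
    by (simp add: formal_inverse_def vec_compose_def vec_eq_iff)
  then have "fps_tpar * N $ i = fps_tpar * mfps_compose (H' $ i) G" for i
    by (simp add: compose_F_G G_nth algebra_simps)
  then have "N $ i = mfps_compose (H' $ i) G" for i
    by (simp add: mfps_eq_iff)
  then show "cauchy_solution H N"
    by (simp add: cauchy_solution_iff_functional_equation)
next
  assume sol: "cauchy_solution H N"
  then have "mfps_compose (H' $ i) G = N $ i" for i
    by (simp add: cauchy_solution_iff_functional_equation)
  then show "formal_inverse G F"
    by (simp add: formal_inverse_def vec_compose_def vec_eq_iff compose_F_G compose_G_F
        compose_N_F[OF sol]) (simp add: G_nth F_nth)
qed

end

lemma order_ge_imp_nth_0: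
  assumes "order_ge U k" and "0 < k"
  shows "mfps_nth (U $ i) 0 = 0"
  using assms unfolding order_ge_def by (metis mdeg_0 not_le)

theorem theorem3p2:
  fixes H :: "(complex, 'n::finite) mfps ^ 'n"
    and N :: "(complex poly, 'n) mfps ^ 'n"
  assumes "order_ge H 2" and "order_ge N 2"
  shows "formal_inverse (G_t N) (F_t H) \<longleftrightarrow>
    cauchy_solution H (vec_map fps_of_poly N) \<and>
    (\<forall>U. cauchy_solution H U \<longrightarrow> U = vec_map fps_of_poly N)"
proof -
  interpret P: coeff_ring_hom "fps_of_poly :: complex poly \<Rightarrow> _"
    by (rule coeff_ring_hom_fps_of_poly)
  let ?N = "vec_map fps_of_poly N"
  have inj: "inj (fps_of_poly :: complex poly \<Rightarrow> _)"
    by (simp add: inj_def fps_of_poly_eq_iff)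
  have t: "mfps_map fps_of_poly tpar = fps_tpar"
    by (simp add: tpar_def P.mfps_map_const fps_of_poly_pCons)
  have H: "vec_map fps_of_poly (vec_map (\<lambda>c. [:c:]) H) = vec_map fps_const H"
    by (simp add: vec_eq_iff vec_map_def mfps_eq_iff fps_of_poly_const)
  have "formal_inverse (G_t N) (F_t H) \<longleftrightarrow>
      formal_inverse (vec_map fps_of_poly (G_t N)) (vec_map fps_of_poly (F_t H))"
    by (simp add: P.formal_inverse_vec_map[OF inj])
  also have "\<dots> \<longleftrightarrow> formal_inverse (zvec + fps_tpar *s ?N) (zvec - fps_tpar *s vec_map fps_const H)"
    by (simp add: G_t_def F_t_def P.vec_map_add P.vec_map_diff P.vec_map_smult P.vec_map_zvec t H)
  also have "\<dots> \<longleftrightarrow> cauchy_solution H ?N"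
  proof (rule formal_inverse_iff_cauchy_solution)
    show "mfps_nth (?N $ i) 0 = 0" for i
      using order_ge_imp_nth_0[OF assms(2)] by (simp add: vec_map_def)
    show "mfps_nth (H $ i) 0 = 0" for i
      using order_ge_imp_nth_0[OF assms(1)] by simp
  qed
  finally show ?thesis
    using cauchy_solution_unique by blast
qed

end
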